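(* Let $\lambda>0$ and the integer $d\ge 2$ be fixed, and for each $n$ suppose that $X_0^{(n)}$ is in the stationary distribution. Let $K>0$ be a constant and let $\tau=\tau(n)=n^{Kd\ln\ln n}$. Then $$\max_{0\le t\le\tau}M_t^{(n)}\ge K\ln\ln n\qquad\text{a.a.s.}$$
   Context: The model ($n$-bin system): let $\lambda>0$ and let $d,n$ be positive integers. There are $n$ bins. Balls arrive in a Poisson process at rate $\lambda n$. Upon arrival each ball chooses $d$ bins independently and uniformly at random (with replacement), and is placed into a least loaded bin among those chosen (load = number of balls in the bin); if there is more than one chosen bin with least load, the ball is placed in the first such bin chosen. Balls have independent exponential lifetimes with mean $1$, after which they disappear. $X_t^{(n)}(j)$ is the number of balls in bin $j$ at time $t$, and $X_t^{(n)}=(X_t^{(n)}(1),\dots,X_t^{(n)}(n))$ is the load vector, a continuous-time Markov chain on $(\mathbb{Z}^+)^n$ with a unique stationary distribution. $M_t^{(n)}=\max_j X_t^{(n)}(j)$ is the maximum load at time $t$. "A.a.s." means with probability tending to $1$ as $n\to\infty$. *)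

theory Defs
  imports "HOL-Probability.Probability"
begin

text \<open>
  One realisation of the randomness driving the system.  Bins are \<open>0, \<dots>, n - 1\<close> and arriving balls
  are numbered \<open>0, 1, \<dots>\<close> in order of arrival.  Ball number \<open>i < initial_load j\<close> initially in bin
  \<open>j\<close> disappears at time \<open>residual_life j i\<close>; \<open>interarrival k\<close> is the time between arrivals \<open>k - 1\<close>
  and \<open>k\<close> (from time \<open>0\<close> if \<open>k = 0\<close>); \<open>choice k i\<close> is the \<open>i\<close>-th bin chosen by ball \<open>k\<close>.
\<close>

record driving =
  initial_load :: "nat \<Rightarrow> nat"
  residual_life :: "nat \<Rightarrow> nat \<Rightarrow> real"
  interarrival :: "nat \<Rightarrow> real"
  choice :: "nat \<Rightarrow> nat \<Rightarrow> nat"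
  lifetime :: "nat \<Rightarrow> real"

definition arrival :: "driving \<Rightarrow> nat \<Rightarrow> real" where
  "arrival w k = (\<Sum>i\<le>k. interarrival w i)"

definition initial_alive :: "driving \<Rightarrow> real \<Rightarrow> nat \<Rightarrow> nat" where
  "initial_alive w t j = card {i. i < initial_load w j \<and> t < residual_life w j i}"

definition first_least_loaded :: "nat \<Rightarrow> (nat \<Rightarrow> nat) \<Rightarrow> (nat \<Rightarrow> nat) \<Rightarrow> nat" where
  "first_least_loaded d x c = c (LEAST i. i < d \<and> (\<forall>i'<d. x (c i) \<le> x (c i')))"

text \<open>The bin receiving ball \<open>k\<close>, decided by the loads just before its arrival.\<close>

context
  notes conj_cong [fundef_cong]
begin

fun ball_bin :: "nat \<Rightarrow> driving \<Rightarrow> nat \<Rightarrow> nat" where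
  "ball_bin d w k =
     first_least_loaded d
       (\<lambda>j. initial_alive w (arrival w k) j +
            card {k'. k' < k \<and> arrival w k < arrival w k' + lifetime w k' \<and> ball_bin d w k' = j})
       (choice w k)"

end

declare ball_bin.simps [simp del]

definition load :: "nat \<Rightarrow> driving \<Rightarrow> real \<Rightarrow> nat \<Rightarrow> nat" where
  "load d w t j = initial_alive w t j +
     card {k. arrival w k \<le> t \<and> t < arrival w k + lifetime w k \<and> ball_bin d w k = j}"

definition load_vector :: "nat \<Rightarrow> nat \<Rightarrow> driving \<Rightarrow> real \<Rightarrow> nat \<Rightarrow> nat" where
  "load_vector d n w t = (\<lambda>j\<in>{..<n}. load d w t j)"

definition max_load :: "nat \<Rightarrow> nat \<Rightarrow> driving \<Rightarrow> real \<Rightarrow> nat" where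
  "max_load d n w t = (MAX j\<in>{..<n}. load_vector d n w t j)"

abbreviation load_space :: "nat \<Rightarrow> (nat \<Rightarrow> nat) measure" where
  "load_space n \<equiv> Pi\<^sub>M {..<n} (\<lambda>_. count_space UNIV)"

text \<open>
  The sources of randomness take values in different types, so their joint independence is stated
  for the generated families of events, as in \<open>indep_vars_def\<close>.
\<close>

datatype source =
  Initial | Residual nat nat | Interarrival nat | Choice nat nat | Lifetime nat

definition events_of :: "'a measure \<Rightarrow> 'b measure \<Rightarrow> ('a \<Rightarrow> 'b) \<Rightarrow> 'a set set" where
  "events_of M N Y = {Y -` A \<inter> space M | A. A \<in> sets N}"

fun source_events :: "nat \<Rightarrow> 'a measure \<Rightarrow> ('a \<Rightarrow> driving) \<Rightarrow> source \<Rightarrow> 'a set set" where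
  "source_events n M D Initial = events_of M (load_space n) (\<lambda>\<omega>. initial_load (D \<omega>))"
| "source_events n M D (Residual j i) = events_of M borel (\<lambda>\<omega>. residual_life (D \<omega>) j i)"
| "source_events n M D (Interarrival k) = events_of M borel (\<lambda>\<omega>. interarrival (D \<omega>) k)"
| "source_events n M D (Choice k i) = events_of M (count_space {..<n}) (\<lambda>\<omega>. choice (D \<omega>) k i)"
| "source_events n M D (Lifetime k) = events_of M borel (\<lambda>\<omega>. lifetime (D \<omega>) k)"

definition sources :: "nat \<Rightarrow> nat \<Rightarrow> source set" where
  "sources d n = {Initial} \<union> {Residual j i | j i. j < n} \<union> range Interarrival \<union>
     {Choice k i | k i. i < d} \<union> range Lifetime"

text \<open>
  The \<open>n\<close>-bin system with an arbitrary initial law.  The Poisson process of rate \<open>\<lambda>n\<close> is given by its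
  independent exponential interarrival times.  By lack of memory, the remaining lifetimes of the
  balls present at time \<open>0\<close> are again independent exponentials of mean \<open>1\<close>.
\<close>

definition n_bin_system ::
    "real \<Rightarrow> nat \<Rightarrow> nat \<Rightarrow> 'a measure \<Rightarrow> ('a \<Rightarrow> driving) \<Rightarrow> bool" where
  "n_bin_system lam d n M D \<longleftrightarrow>
     prob_space M \<and>
     (\<lambda>\<omega>. initial_load (D \<omega>)) \<in> measurable M (load_space n) \<and>
     (\<forall>j<n. \<forall>i. distributed M lborel (\<lambda>\<omega>. residual_life (D \<omega>) j i) (exponential_density 1)) \<and>
     (\<forall>k. distributed M lborel (\<lambda>\<omega>. interarrival (D \<omega>) k) (exponential_density (lam * real n))) \<and>
     (\<forall>k. \<forall>i<d. (\<lambda>\<omega>. choice (D \<omega>) k i) \<in> measurable M (count_space {..<n}) \<and>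
        distr M (count_space {..<n}) (\<lambda>\<omega>. choice (D \<omega>) k i) = uniform_count_measure {..<n}) \<and>
     (\<forall>k. distributed M lborel (\<lambda>\<omega>. lifetime (D \<omega>) k) (exponential_density 1)) \<and>
     prob_space.indep_sets M (source_events n M D) (sources d n)"

text \<open>
  The law of the initial load vector is stationary: the chain started from it has that same law at
  all times.
\<close>

definition starts_stationary :: "nat \<Rightarrow> nat \<Rightarrow> 'a measure \<Rightarrow> ('a \<Rightarrow> driving) \<Rightarrow> bool" where
  "starts_stationary d n M D \<longleftrightarrow>
     (\<forall>t\<ge>0. distr M (load_space n) (\<lambda>\<omega>. load_vector d n (D \<omega>) t) =
             distr M (load_space n) (\<lambda>\<omega>. initial_load (D \<omega>)))"

text \<open>
  Almost surely only finitely many balls arrive by time \<open>T\<close>, so almost surely the set below is a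
  finite nonempty set of naturals.  On the exceptional null set (infinitely many arrivals by \<open>T\<close>)
  the value is irrelevant, but measurability may fail there; probabilities of events about this
  maximum are therefore taken in the completion of the underlying probability space.
\<close>

definition max_load_upto :: "nat \<Rightarrow> nat \<Rightarrow> driving \<Rightarrow> real \<Rightarrow> nat" where
  "max_load_upto d n w T = (MAX t\<in>{0..T}. max_load d n w t)"

end

theory Submission
  imports Defs "HOL-Real_Asymp.Real_Asymp"
begin

text \<open>
  Let \<open>h\<close> be \<open>K ln ln n\<close> rounded up and cut the arrivals into blocks of \<open>h\<close> consecutive balls.  Wherever
  the first ball of a block goes, the other \<open>h - 1\<close> balls all choose that same bin \<open>d\<close> times with
  probability \<open>n\<close> to the power \<open>- d (h - 1)\<close>, which is at least \<open>1 / \<tau>\<close>; that none of the \<open>h\<close> balls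
  disappears during the block costs only a power of \<open>ln n\<close>.  Conditionally on the past every block
  succeeds with at least this probability, and about \<open>\<lambda> \<surd>n \<tau> / h\<close> blocks, enough for one to succeed,
  are over by time \<open>\<tau>\<close>, by Markov's inequality for the arrival time of the last ball.
\<close>

subsection \<open>Paths of the system\<close>

lemma least_loaded_index_less:
  fixes x :: "nat \<Rightarrow> nat" and d :: nat
  assumes "d > 0"
  shows "(LEAST i. i < d \<and> (\<forall>i'<d. x (c i) \<le> x (c i'))) < d"
proof -
  have "\<exists>i. i < d \<and> (\<forall>i'<d. x (c i) \<le> x (c i'))"
    using ex_has_least_nat[of "\<lambda>i. i < d" 0 "\<lambda>i. x (c i)"] assms by auto
  then have "(LEAST i. i < d \<and> (\<forall>i'<d. x (c i) \<le> x (c i'))) < d \<and>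
      (\<forall>i'<d. x (c (LEAST i. i < d \<and> (\<forall>i'<d. x (c i) \<le> x (c i')))) \<le> x (c i'))"
    by (rule LeastI_ex)
  then show ?thesis ..
qed

lemma first_least_loaded_const:
  assumes "d > 0" "\<And>i. i < d \<Longrightarrow> c i = j"
  shows "first_least_loaded d x c = j"
  using least_loaded_index_less[OF assms(1), of x c] assms(2)
  by (simp add: first_least_loaded_def)

text \<open>When all \<open>d\<close> choices agree, comparing loads has no effect. The destination
  of a stacking ball is thus decided by its choices alone, which are independent of the
  past.\<close>

lemma ball_bin_const:
  assumes "d > 0" "\<And>i. i < d \<Longrightarrow> choice w k i = j"
  shows "ball_bin d w k = j"
  by (subst ball_bin.simps) (rule first_least_loaded_const[OF assms])

lemma ball_bin_less:
  assumes "d > 0" "\<And>i. i < d \<Longrightarrow> choice w k i < n"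
  shows "ball_bin d w k < n"
  by (subst ball_bin.simps)
    (auto simp: first_least_loaded_def intro!: assms(2) least_loaded_index_less[OF assms(1)])

lemma arrival_mono:
  assumes "\<And>i. 0 \<le> interarrival w i" "k \<le> l"
  shows "arrival w k \<le> arrival w l"
  unfolding arrival_def using assms by (intro sum_mono2) auto

lemma arrival_nonneg: "(\<And>i. 0 \<le> interarrival w i) \<Longrightarrow> 0 \<le> arrival w k"
  by (simp add: arrival_def sum_nonneg)

lemma arrival_diff:
  assumes "k \<le> l"
  shows "arrival w l = arrival w k + (\<Sum>i\<in>{k<..l}. interarrival w i)"
proof -
  have "{..l} = {..k} \<union> {k<..l}" using assms by auto
  then show ?thesis unfolding arrival_def by (simp add: sum.union_disjoint ivl_disj_int)
qed

text \<open>The inequalities force the last of the \<open>h\<close> balls to arrive before any of them disappears.\<close>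

definition stacks :: "nat \<Rightarrow> nat \<Rightarrow> driving \<Rightarrow> nat \<Rightarrow> bool" where
  "stacks d h w m \<longleftrightarrow>
     (\<forall>l\<in>{m<..<m + h}. interarrival w l \<le> 1 / real h \<and> (\<forall>i<d. choice w l i = ball_bin d w m)) \<and>
     (\<forall>l\<in>{m..<m + h}. 1 < lifetime w l)"

text \<open>At the arrival of the last ball of the block, each of its balls has been present for at
  most \<open>h - 1\<close> gaps of length at most \<open>1 / h\<close>. This is less than its
  lifetime, so all \<open>h\<close> balls are still in the bin of the first one.\<close>

lemma stacks_load:
  assumes d: "d > 0" and h: "h > 0" and ia: "\<And>i. 0 \<le> interarrival w i"
    and fin: "finite {k. arrival w k \<le> T}" and T: "arrival w (m + h - 1) \<le> T"
    and st: "stacks d h w m"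
  shows "h \<le> load d w (arrival w (m + h - 1)) (ball_bin d w m)"
proof -
  let ?t = "arrival w (m + h - 1)"
  let ?S = "{k. arrival w k \<le> ?t \<and> ?t < arrival w k + lifetime w k \<and> ball_bin d w k = ball_bin d w m}"
  have "{m..<m + h} \<subseteq> ?S"
  proof
    fix l assume l: "l \<in> {m..<m + h}"
    have "ball_bin d w l = ball_bin d w m"
    proof (cases "l = m")
      case False
      then show ?thesis using l st d by (intro ball_bin_const) (auto simp: stacks_def)
    qed simp
    moreover have "?t < arrival w l + lifetime w l"
    proof -
      have "(\<Sum>i\<in>{l<..m + h - 1}. interarrival w i) \<le> (\<Sum>i\<in>{l<..m + h - 1}. 1 / real h)"
        using l st by (intro sum_mono) (auto simp: stacks_def)
      also have "\<dots> = real (m + h - 1 - l) / real h" by simp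
      also have "\<dots> \<le> 1" using h l by (simp add: field_simps)
      also have "1 < lifetime w l" using l st by (auto simp: stacks_def)
      finally show ?thesis using arrival_diff[of l "m + h - 1" w] l h by auto
    qed
    moreover have "arrival w l \<le> ?t" using l by (intro arrival_mono ia) auto
    ultimately show "l \<in> ?S" by simp
  qed
  \<comment> \<open>Finiteness is essential: \<open>card\<close> of an infinite set is 0, so the
    inclusion alone would give no lower bound on the load.\<close>
  moreover have "finite ?S"
    by (rule finite_subset[OF _ fin]) (use T in auto)
  ultimately have "h \<le> card ?S" using card_mono[of ?S "{m..<m + h}"] by simp
  then show ?thesis by (simp add: load_def)
qed

text \<open>Loads increase only at arrivals. Going back from \<open>t\<close> to the last arrival
  before it, or to time 0 if there is none, can therefore only increase the load of a bin.\<close>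

lemma load_le_load_at_jump:
  assumes ia: "\<And>i. 0 \<le> interarrival w i" and fin: "finite {k. arrival w k \<le> T}"
    and t: "0 \<le> t" "t \<le> T"
  shows "load d w t j \<le> load d w 0 j \<or>
    (\<exists>m. arrival w m \<le> T \<and> load d w t j \<le> load d w (arrival w m) j)"
proof -
  \<comment> \<open>The assumption \<open>arr\<close> says that no ball arrives after
    \<open>s\<close> and up to \<open>t\<close>, so in between balls only disappear.\<close>
  have le: "load d w t j \<le> load d w s j"
    if s: "s \<le> t" and arr: "\<And>k. arrival w k \<le> t \<Longrightarrow> arrival w k \<le> s" for s
  proof -
    have "card {i. i < initial_load w j \<and> t < residual_life w j i}
        \<le> card {i. i < initial_load w j \<and> s < residual_life w j i}"
      using s by (intro card_mono) auto
    moreover have "card {k. arrival w k \<le> t \<and> t < arrival w k + lifetime w k \<and> ball_bin d w k = j}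
        \<le> card {k. arrival w k \<le> s \<and> s < arrival w k + lifetime w k \<and> ball_bin d w k = j}"
    proof (rule card_mono)
      show "finite {k. arrival w k \<le> s \<and> s < arrival w k + lifetime w k \<and> ball_bin d w k = j}"
        by (rule finite_subset[OF _ fin]) (use s t in auto)
    qed (use s arr in \<open>auto intro: le_less_trans\<close>)
    ultimately show ?thesis by (simp add: load_def initial_alive_def)
  qed
  have fint: "finite {k. arrival w k \<le> t}"
    by (rule finite_subset[OF _ fin]) (use t in auto)
  show ?thesis
  proof (cases "{k. arrival w k \<le> t} = {}")
    case True
    then show ?thesis using le[of 0] t by auto
  next
    case False
    define m where "m = Max {k. arrival w k \<le> t}"
    have "m \<in> {k. arrival w k \<le> t}" unfolding m_def by (rule Max_in[OF fint False])
    moreover have "arrival w k \<le> arrival w m" if "arrival w k \<le> t" for k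
      by (intro arrival_mono ia) (use that fint in \<open>auto simp: m_def\<close>)
    ultimately show ?thesis using le[of "arrival w m"] t by auto
  qed
qed

lemma le_max_load_iff:
  assumes "n > 0"
  shows "h \<le> max_load d n w t \<longleftrightarrow> (\<exists>j<n. h \<le> load d w t j)"
proof -
  have "h \<le> max_load d n w t \<longleftrightarrow> (\<exists>j\<in>{..<n}. h \<le> load_vector d n w t j)"
    unfolding max_load_def using assms by (subst Max_ge_iff) auto
  also have "\<dots> \<longleftrightarrow> (\<exists>j<n. h \<le> load d w t j)" by (auto simp: load_vector_def)
  finally show ?thesis .
qed

text \<open>This replaces the uncountably many times in the maximum by time 0 and the countably many
  arrival times, from which measurability up to a null set will follow.\<close>

lemma le_max_load_upto_iff:
  assumes n: "n > 0" and T: "0 \<le> T"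
    and ia: "\<And>i. 0 \<le> interarrival w i" and fin: "finite {k. arrival w k \<le> T}"
  shows "h \<le> max_load_upto d n w T \<longleftrightarrow>
    (\<exists>j<n. h \<le> load d w 0 j \<or> (\<exists>m. arrival w m \<le> T \<and> h \<le> load d w (arrival w m) j))"
proof -
  \<comment> \<open>A bound uniform in \<open>t\<close> makes the set of values finite, so that
    \<open>MAX\<close> is a genuine maximum.\<close>
  have bound: "max_load d n w t \<le> (\<Sum>j<n. initial_load w j) + card {k. arrival w k \<le> T}"
    if "t \<in> {0..T}" for t
  proof -
    obtain j where j: "j < n" "max_load d n w t \<le> load d w t j"
      using le_max_load_iff[OF n, of "max_load d n w t" d w t] by auto
    have "load d w t j \<le> initial_load w j + card {k. arrival w k \<le> T}"
      unfolding load_def initial_alive_def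
    proof (rule add_mono)
      show "card {i. i < initial_load w j \<and> t < residual_life w j i} \<le> initial_load w j"
        using card_mono[of "{..<initial_load w j}" "{i. i < initial_load w j \<and> t < residual_life w j i}"]
        by auto
      show "card {k. arrival w k \<le> t \<and> t < arrival w k + lifetime w k \<and> ball_bin d w k = j}
          \<le> card {k. arrival w k \<le> T}"
        using that by (intro card_mono fin) auto
    qed
    also have "initial_load w j \<le> (\<Sum>j<n. initial_load w j)"
      using j by (intro member_le_sum) auto
    finally show ?thesis using j by simp
  qed
  have "finite (max_load d n w ` {0..T})"
    by (rule finite_subset[of _ "{..(\<Sum>j<n. initial_load w j) + card {k. arrival w k \<le> T}}"])
      (use bound in auto)
  then have "h \<le> max_load_upto d n w T \<longleftrightarrow> (\<exists>t\<in>{0..T}. h \<le> max_load d n w t)"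
    unfolding max_load_upto_def using T by (subst Max_ge_iff) auto
  also have "\<dots> \<longleftrightarrow> (\<exists>t\<in>{0..T}. \<exists>j<n. h \<le> load d w t j)"
    by (simp add: le_max_load_iff[OF n])
  also have "\<dots> \<longleftrightarrow>
    (\<exists>j<n. h \<le> load d w 0 j \<or> (\<exists>m. arrival w m \<le> T \<and> h \<le> load d w (arrival w m) j))"
  proof (intro iffI)
    assume "\<exists>t\<in>{0..T}. \<exists>j<n. h \<le> load d w t j"
    then obtain t j where t: "0 \<le> t" "t \<le> T" and j: "j < n" "h \<le> load d w t j" by auto
    show "\<exists>j<n. h \<le> load d w 0 j \<or> (\<exists>m. arrival w m \<le> T \<and> h \<le> load d w (arrival w m) j)"
    proof (intro exI conjI)
      show "h \<le> load d w 0 j \<or> (\<exists>m. arrival w m \<le> T \<and> h \<le> load d w (arrival w m) j)"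
        using load_le_load_at_jump[OF ia fin t, of d j] j(2) by (elim disjE exE) auto
    qed (rule j)
  next
    assume "\<exists>j<n. h \<le> load d w 0 j \<or> (\<exists>m. arrival w m \<le> T \<and> h \<le> load d w (arrival w m) j)"
    then obtain j where j: "j < n"
      and "h \<le> load d w 0 j \<or> (\<exists>m. arrival w m \<le> T \<and> h \<le> load d w (arrival w m) j)"
      by blast
    then obtain t where "t \<in> {0..T}" "h \<le> load d w t j"
      using T arrival_nonneg[OF ia] by auto
    with j show "\<exists>t\<in>{0..T}. \<exists>j<n. h \<le> load d w t j" by blast
  qed
  finally show ?thesis .
qed

subsection \<open>Measurability\<close>

text \<open>
  The measurable space \<open>N\<close> is arbitrary because the results are applied both to the full probability
  space and to the sigma-algebra of the past of a ball.
\<close>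

definition driven_by :: "nat \<Rightarrow> nat \<Rightarrow> 'a measure \<Rightarrow> ('a \<Rightarrow> driving) \<Rightarrow> nat \<Rightarrow> bool" where
  "driven_by d n N D k \<longleftrightarrow>
     (\<forall>j<n. (\<lambda>\<omega>. initial_load (D \<omega>) j) \<in> measurable N (count_space UNIV)) \<and>
     (\<forall>j<n. \<forall>i. (\<lambda>\<omega>. residual_life (D \<omega>) j i) \<in> borel_measurable N) \<and>
     (\<forall>l\<le>k. (\<lambda>\<omega>. interarrival (D \<omega>) l) \<in> borel_measurable N) \<and>
     (\<forall>l\<le>k. \<forall>i<d. (\<lambda>\<omega>. choice (D \<omega>) l i) \<in> measurable N (count_space {..<n})) \<and>
     (\<forall>l<k. (\<lambda>\<omega>. lifetime (D \<omega>) l) \<in> borel_measurable N)"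

lemma driven_by_mono: "driven_by d n N D k \<Longrightarrow> l \<le> k \<Longrightarrow> driven_by d n N D l"
  unfolding driven_by_def by auto

lemma measurable_arrival:
  assumes "driven_by d n N D k"
  shows "(\<lambda>\<omega>. arrival (D \<omega>) k) \<in> borel_measurable N"
  unfolding arrival_def by (rule borel_measurable_sum) (use assms in \<open>auto simp: driven_by_def\<close>)

text \<open>The time is allowed to be random because a ball inspects the loads at its own arrival
  time.\<close>

lemma measurable_initial_alive:
  assumes dr: "driven_by d n N D k" and j: "j < n" and [measurable]: "t \<in> borel_measurable N"
  shows "(\<lambda>\<omega>. initial_alive (D \<omega>) (t \<omega>) j) \<in> measurable N (count_space UNIV)"
proof -
  have [measurable]: "(\<lambda>\<omega>. initial_load (D \<omega>) j) \<in> measurable N (count_space UNIV)"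
    "\<And>i. (\<lambda>\<omega>. residual_life (D \<omega>) j i) \<in> borel_measurable N"
    using dr j by (auto simp: driven_by_def)
  show ?thesis unfolding initial_alive_def
    by (rule measurable_card) measurable
qed

text \<open>Both arguments take countably many values, so nothing has to be assumed of
  \<open>F\<close>. Taking relations for \<open>F\<close> covers predicates as well.\<close>

lemma measurable_nat_binop:
  fixes f g :: "'a \<Rightarrow> nat"
  assumes f: "f \<in> measurable N (count_space UNIV)" and g: "g \<in> measurable N (count_space UNIV)"
  shows "(\<lambda>\<omega>. F (f \<omega>) (g \<omega>)) \<in> measurable N (count_space UNIV)"
proof (rule measurable_compose_countable'[where I = UNIV and f = "\<lambda>i \<omega>. F i (g \<omega>)", OF _ f])
  show "(\<lambda>\<omega>. F i (g \<omega>)) \<in> measurable N (count_space UNIV)" for i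
    by (rule measurable_compose[OF g]) simp
qed simp

lemma measurable_first_least_loaded:
  assumes d: "d > 0"
    and x: "\<And>j. j < n \<Longrightarrow> (\<lambda>\<omega>. x \<omega> j) \<in> measurable N (count_space (UNIV :: nat set))"
    and c: "\<And>i. i < d \<Longrightarrow> (\<lambda>\<omega>. c \<omega> i) \<in> measurable N (count_space {..<n})"
  shows "(\<lambda>\<omega>. first_least_loaded d (x \<omega>) (c \<omega>)) \<in> measurable N (count_space UNIV)"
proof -
  let ?I = "\<lambda>\<omega>. LEAST i. i < d \<and> (\<forall>i'<d. x \<omega> (c \<omega> i) \<le> x \<omega> (c \<omega> i'))"
  have xc: "(\<lambda>\<omega>. x \<omega> (c \<omega> i)) \<in> measurable N (count_space UNIV)" if "i < d" for i
    by (rule measurable_compose_countable'[where I = "{..<n}" and f = "\<lambda>j \<omega>. x \<omega> j", OF x c])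
      (use that in auto)
  have "?I \<in> measurable N (count_space UNIV)"
  proof (rule measurable_Least)
    fix i
    show "Measurable.pred N (\<lambda>\<omega>. i < d \<and> (\<forall>i'<d. x \<omega> (c \<omega> i) \<le> x \<omega> (c \<omega> i')))"
    proof (cases "i < d")
      case True
      have "Measurable.pred N (\<lambda>\<omega>. \<forall>i'\<in>{..<d}. x \<omega> (c \<omega> i) \<le> x \<omega> (c \<omega> i'))"
      proof (rule pred_intros_finite(3))
        fix i' assume "i' \<in> {..<d}"
        then have "i' < d" by simp
        show "Measurable.pred N (\<lambda>\<omega>. x \<omega> (c \<omega> i) \<le> x \<omega> (c \<omega> i'))"
          by (rule measurable_nat_binop[where F = "(\<le>)", OF xc[OF True] xc[OF \<open>i' < d\<close>]])
      qed simp
      with True show ?thesis by (simp only: Ball_def lessThan_iff simp_thms)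
    qed simp
  qed
  \<comment> \<open>Shrinking the range of the random index to \<open>{..<d}\<close> leaves only the
    choices with index below \<open>d\<close> to be measurable in the composition below.\<close>
  then have I: "?I \<in> measurable N (count_space {..<d})"
    by (rule measurable_count_space_extend[rotated 2]) (simp_all add: least_loaded_index_less[OF d])
  show ?thesis unfolding first_least_loaded_def
  proof (rule measurable_compose_countable'[where I = "{..<d}" and f = "\<lambda>i \<omega>. c \<omega> i", OF _ I])
    fix i assume "i \<in> {..<d}"
    then have "i < d" by simp
    show "(\<lambda>\<omega>. c \<omega> i) \<in> measurable N (count_space UNIV)"
      by (rule measurable_compose[OF c[OF \<open>i < d\<close>] measurable_count_space])
  qed simp
qed

text \<open>Strong induction along the recursion: the bin of ball \<open>k\<close> depends on the
  bins and lifetimes of strictly earlier balls, which matches the strict bound on lifetimes in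
  \<open>driven_by\<close>.\<close>

lemma measurable_ball_bin:
  assumes d: "d > 0" and "driven_by d n N D k"
  shows "(\<lambda>\<omega>. ball_bin d (D \<omega>) k) \<in> measurable N (count_space UNIV)"
  using assms(2)
proof (induction k rule: less_induct)
  case (less k)
  have IH: "(\<lambda>\<omega>. ball_bin d (D \<omega>) l) \<in> measurable N (count_space UNIV)"
    if "l < k" for l
    using less.IH[OF that] driven_by_mono[OF less.prems] that by simp
  have arr: "(\<lambda>\<omega>. arrival (D \<omega>) l) \<in> borel_measurable N" if "l \<le> k" for l
    by (rule measurable_arrival[OF driven_by_mono[OF less.prems that]])
  have life: "(\<lambda>\<omega>. lifetime (D \<omega>) l) \<in> borel_measurable N" if "l < k" for l
    using less.prems that by (simp add: driven_by_def)
  have later: "(\<lambda>\<omega>. card {l. l < k \<and> arrival (D \<omega>) k < arrival (D \<omega>) l + lifetime (D \<omega>) l \<and>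
      ball_bin d (D \<omega>) l = j}) \<in> measurable N (count_space UNIV)" for j
  proof (rule measurable_card)
    fix l
    show "{\<omega> \<in> space N. l \<in> {l. l < k \<and> arrival (D \<omega>) k < arrival (D \<omega>) l + lifetime (D \<omega>) l \<and>
      ball_bin d (D \<omega>) l = j}} \<in> sets N"
    proof (cases "l < k")
      case True
      then have [measurable]: "(\<lambda>\<omega>. arrival (D \<omega>) l) \<in> borel_measurable N"
        "(\<lambda>\<omega>. arrival (D \<omega>) k) \<in> borel_measurable N"
        "(\<lambda>\<omega>. lifetime (D \<omega>) l) \<in> borel_measurable N"
        "(\<lambda>\<omega>. ball_bin d (D \<omega>) l) \<in> measurable N (count_space UNIV)"
        using arr life IH by auto
      show ?thesis using True by simp
    qed simp
  qed
  show ?case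
    unfolding ball_bin.simps[of d _ k]
  proof (rule measurable_first_least_loaded[OF d])
    fix j assume j: "j < n"
    show "(\<lambda>\<omega>. initial_alive (D \<omega>) (arrival (D \<omega>) k) j + card {k'. k' < k \<and>
        arrival (D \<omega>) k < arrival (D \<omega>) k' + lifetime (D \<omega>) k' \<and> ball_bin d (D \<omega>) k' = j})
      \<in> measurable N (count_space UNIV)"
      by (rule measurable_nat_binop[where F = "(+)",
        OF measurable_initial_alive[OF less.prems j arr[OF order_refl]] later])
  next
    show "\<And>i. i < d \<Longrightarrow> (\<lambda>\<omega>. choice (D \<omega>) k i) \<in> measurable N (count_space {..<n})"
      using less.prems by (simp add: driven_by_def)
  qed
qed

lemma measurable_load:
  assumes d: "d > 0" and dr: "\<And>k. driven_by d n N D k" and j: "j < n"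
    and t [measurable]: "t \<in> borel_measurable N"
  shows "(\<lambda>\<omega>. load d (D \<omega>) (t \<omega>) j) \<in> measurable N (count_space UNIV)"
proof -
  have life: "\<And>l. (\<lambda>\<omega>. lifetime (D \<omega>) l) \<in> borel_measurable N"
    using dr by (auto simp: driven_by_def)
  note [measurable] = measurable_arrival[OF dr] measurable_ball_bin[OF d dr] life
    measurable_initial_alive[OF dr j t]
  have [measurable]: "(\<lambda>\<omega>. card {k. arrival (D \<omega>) k \<le> t \<omega> \<and> t \<omega> < arrival (D \<omega>) k + lifetime (D \<omega>) k \<and>
      ball_bin d (D \<omega>) k = j}) \<in> measurable N (count_space UNIV)"
    by (rule measurable_card) measurable
  show ?thesis unfolding load_def by measurable
qed

lemma measurable_stacks:
  assumes d: "d > 0" and dr: "driven_by d n N D (m + h)"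
  shows "Measurable.pred N (\<lambda>\<omega>. stacks d h (D \<omega>) m)"
proof -
  have bin: "(\<lambda>\<omega>. ball_bin d (D \<omega>) m) \<in> measurable N (count_space UNIV)"
    by (rule measurable_ball_bin[OF d driven_by_mono[OF dr]]) simp
  have 1: "Measurable.pred N (\<lambda>\<omega>. interarrival (D \<omega>) l \<le> 1 / real h \<and>
      (\<forall>i\<in>{..<d}. choice (D \<omega>) l i = ball_bin d (D \<omega>) m))" if "l \<in> {m<..<m + h}" for l
  proof -
    have [measurable]: "(\<lambda>\<omega>. interarrival (D \<omega>) l) \<in> borel_measurable N"
      using dr that by (auto simp: driven_by_def)
    have c: "(\<lambda>\<omega>. choice (D \<omega>) l i) \<in> measurable N (count_space UNIV)" if "i < d" for i
    proof (rule measurable_compose[OF _ measurable_count_space])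
      show "(\<lambda>\<omega>. choice (D \<omega>) l i) \<in> measurable N (count_space {..<n})"
        using dr that \<open>l \<in> _\<close> by (simp add: driven_by_def)
    qed
    have "Measurable.pred N (\<lambda>\<omega>. \<forall>i\<in>{..<d}. choice (D \<omega>) l i = ball_bin d (D \<omega>) m)"
    proof (rule pred_intros_finite(3))
      fix i assume "i \<in> {..<d}"
      then have "i < d" by simp
      show "Measurable.pred N (\<lambda>\<omega>. choice (D \<omega>) l i = ball_bin d (D \<omega>) m)"
        by (rule measurable_nat_binop[where F = "(=)", OF c[OF \<open>i < d\<close>] bin])
    qed simp
    then show ?thesis by measurable
  qed
  have 2: "Measurable.pred N (\<lambda>\<omega>. 1 < lifetime (D \<omega>) l)" if "l \<in> {m..<m + h}" for l
  proof -
    have [measurable]: "(\<lambda>\<omega>. lifetime (D \<omega>) l) \<in> borel_measurable N"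
      using dr that by (auto simp: driven_by_def)
    show ?thesis by measurable
  qed
  have "Measurable.pred N (\<lambda>\<omega>. (\<forall>l\<in>{m<..<m + h}. interarrival (D \<omega>) l \<le> 1 / real h \<and>
     (\<forall>i\<in>{..<d}. choice (D \<omega>) l i = ball_bin d (D \<omega>) m)) \<and> (\<forall>l\<in>{m..<m + h}. 1 < lifetime (D \<omega>) l))"
    by (intro pred_intros_logic(3) pred_intros_finite(3) 1 2 finite_greaterThanLessThan
      finite_atLeastLessThan)
  then show ?thesis by (simp only: stacks_def Ball_def lessThan_iff)
qed

subsection \<open>Independence of the past and of the next balls\<close>

lemma Int_stable_events_of: "Int_stable (events_of M N Y)"
proof (rule Int_stableI)
  fix a b assume "a \<in> events_of M N Y" "b \<in> events_of M N Y"
  then obtain A B where "a = Y -` A \<inter> space M" "A \<in> sets N" "b = Y -` B \<inter> space M" "B \<in> sets N"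
    by (auto simp: events_of_def)
  then show "a \<inter> b \<in> events_of M N Y"
    unfolding events_of_def by (intro CollectI exI[of _ "A \<inter> B"]) auto
qed

lemma in_events_ofI: "A \<in> sets N \<Longrightarrow> E = Y -` A \<inter> space M \<Longrightarrow> E \<in> events_of M N Y"
  by (auto simp: events_of_def)

text \<open>This turns inclusion of generated events into measurability on a coarser algebra, which
  is how the past of a ball enters.\<close>

lemma measurable_events_of:
  assumes "Y \<in> space M \<rightarrow> space X" "space N = space M" "events_of M X Y \<subseteq> sets N"
  shows "Y \<in> measurable N X"
  using assms by (auto simp: measurable_def events_of_def)

lemma Int_stable_source_events: "Int_stable (source_events n M D s)"
  by (cases s) (simp_all add: Int_stable_events_of)

text \<open>Grouping the sources into \<open>P\<close> and \<open>Q\<close> gives two independent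
  sigma-algebras, because the generators are closed under intersection. The event on the
  \<open>Q\<close> side then factors further over its individual sources.\<close>

lemma (in prob_space) indep_sets_prob_Int_INT:
  assumes ind: "indep_sets E (P \<union> Q)" and disj: "P \<inter> Q = {}" and Q: "finite Q" "Q \<noteq> {}"
    and stable: "\<And>i. Int_stable (E i)"
    and X: "X \<in> sigma_sets (space M) (\<Union>i\<in>P. E i)" and A: "\<And>s. s \<in> Q \<Longrightarrow> A s \<in> E s"
  shows "prob (X \<inter> (\<Inter>s\<in>Q. A s)) = prob X * (\<Prod>s\<in>Q. prob (A s))"
proof -
  let ?I = "\<lambda>b. if b then P else Q"
  let ?F = "\<lambda>b. sigma_sets (space M) (\<Union>i\<in>?I b. E i)"
  have sets: "E s \<subseteq> sets M" if "s \<in> Q" for s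
    using ind that by (auto simp: indep_sets_def)
  have "(\<Union>b\<in>UNIV. ?I b) = P \<union> Q" by (auto split: if_splits)
  \<comment> \<open>The two groups are indexed by the Booleans, \<open>True\<close> for
    \<open>P\<close> and \<open>False\<close> for \<open>Q\<close>.\<close>
  then have ind2: "indep_sets ?F UNIV"
    using ind disj by (intro indep_sets_collect_sigma stable) (auto simp: disjoint_family_on_def)
  have "(\<Inter>s\<in>Q. A s) \<in> sigma_sets (space M) (\<Union>i\<in>Q. E i)"
  proof -
    have Pow: "(\<Union>i\<in>Q. E i) \<subseteq> Pow (space M)" using sets sets.sets_into_space by blast
    have "(\<Inter>s\<in>Q. A s) \<in> sets (sigma (space M) (\<Union>i\<in>Q. E i))"
      using A by (intro sets.finite_INT Q) (auto simp: Pow intro: sigma_sets.Basic)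
    then show ?thesis using Pow by simp
  qed
  with X have "prob (\<Inter>b\<in>UNIV. if b then X else (\<Inter>s\<in>Q. A s))
      = (\<Prod>b\<in>UNIV. prob (if b then X else (\<Inter>s\<in>Q. A s)))"
    by (intro indep_setsD[OF ind2]) auto
  then have "prob (X \<inter> (\<Inter>s\<in>Q. A s)) = prob X * prob (\<Inter>s\<in>Q. A s)"
    by (simp add: UNIV_bool Int_commute mult.commute)
  also have "prob (\<Inter>s\<in>Q. A s) = (\<Prod>s\<in>Q. prob (A s))"
    by (rule indep_setsD[OF ind]) (use Q A in auto)
  finally show ?thesis .
qed

text \<open>These sources determine the bin of ball \<open>m\<close>. Its own lifetime is left out,
  since survival of ball \<open>m\<close> is part of the success of the block that it
  starts.\<close>

definition past :: "nat \<Rightarrow> nat \<Rightarrow> nat \<Rightarrow> source set" where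
  "past d n m = {Initial} \<union> {Residual j i | j i. j < n} \<union> Interarrival ` {..m} \<union>
     {Choice l i | l i. l \<le> m \<and> i < d} \<union> Lifetime ` {..<m}"

definition upcoming :: "nat \<Rightarrow> nat \<Rightarrow> nat \<Rightarrow> source set" where
  "upcoming d h m = Interarrival ` {m<..<m + h} \<union>
     (\<lambda>(l, i). Choice l i) ` ({m<..<m + h} \<times> {..<d}) \<union> Lifetime ` {m..<m + h}"

text \<open>Fixing the target bin \<open>j\<close> splits stacking into one condition per upcoming
  source, so that independence gives a product.\<close>

fun stack_event :: "'a measure \<Rightarrow> ('a \<Rightarrow> driving) \<Rightarrow> nat \<Rightarrow> nat \<Rightarrow> source \<Rightarrow> 'a set" where
  "stack_event M D h j (Interarrival l) = {\<omega> \<in> space M. interarrival (D \<omega>) l \<le> 1 / real h}"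
| "stack_event M D h j (Choice l i) = {\<omega> \<in> space M. choice (D \<omega>) l i = j}"
| "stack_event M D h j (Lifetime l) = {\<omega> \<in> space M. 1 < lifetime (D \<omega>) l}"
| "stack_event M D h j _ = space M"

definition stack_prob :: "real \<Rightarrow> nat \<Rightarrow> nat \<Rightarrow> nat \<Rightarrow> real" where
  "stack_prob lam d n h =
     (1 - exp (- (lam * real n / real h))) ^ (h - 1) * (1 / real n) ^ ((h - 1) * d) * exp (- 1) ^ h"

section \<open>One system with a fixed number of bins, and the algebra of the past of a ball\<close>

locale n_bins = prob_space M for M :: "'a measure" +
  fixes lam :: real and d n :: nat and D :: "'a \<Rightarrow> driving"
  assumes system: "n_bin_system lam d n M D"
    and lam: "lam > 0" and d: "d > 0" and n: "n > 0"
begin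

lemma initial_load_measurable:
  "(\<lambda>\<omega>. initial_load (D \<omega>)) \<in> measurable M (load_space n)"
  using system by (simp add: n_bin_system_def)

lemma interarrival_distributed:
  "distributed M lborel (\<lambda>\<omega>. interarrival (D \<omega>) k) (exponential_density (lam * real n))"
  using system by (simp add: n_bin_system_def)

lemma interarrival_measurable: "(\<lambda>\<omega>. interarrival (D \<omega>) k) \<in> borel_measurable M"
  using distributed_measurable[OF interarrival_distributed] by simp

lemma choice_measurable: "i < d \<Longrightarrow> (\<lambda>\<omega>. choice (D \<omega>) k i) \<in> measurable M (count_space {..<n})"
  using system by (simp add: n_bin_system_def)

lemma choice_distr: "i < d \<Longrightarrow>
    distr M (count_space {..<n}) (\<lambda>\<omega>. choice (D \<omega>) k i) = uniform_count_measure {..<n}"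
  using system by (simp add: n_bin_system_def)

lemma lifetime_distributed:
  "distributed M lborel (\<lambda>\<omega>. lifetime (D \<omega>) k) (exponential_density 1)"
  using system by (simp add: n_bin_system_def)

lemma sources_indep: "indep_sets (source_events n M D) (sources d n)"
  using system by (simp add: n_bin_system_def)

lemma driven_by_source_events:
  assumes sp: "space N = space M" and ev: "\<And>s. s \<in> past d n m \<Longrightarrow> source_events n M D s \<subseteq> sets N"
  shows "driven_by d n N D m"
  unfolding driven_by_def
proof (intro conjI allI impI)
  fix j assume j: "j < n"
  have "(\<lambda>\<omega>. initial_load (D \<omega>)) \<in> measurable N (load_space n)"
    using ev[of Initial] measurable_space[OF initial_load_measurable]
    by (intro measurable_events_of[OF _ sp]) (auto simp: past_def)
  then show "(\<lambda>\<omega>. initial_load (D \<omega>) j) \<in> measurable N (count_space UNIV)"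
    by (rule measurable_compose) (use j in \<open>auto intro: measurable_component_singleton\<close>)
  show "(\<lambda>\<omega>. residual_life (D \<omega>) j i) \<in> borel_measurable N" for i
    using ev[of "Residual j i"] j by (intro measurable_events_of[OF _ sp]) (auto simp: past_def)
next
  fix l assume l: "l \<le> m"
  show "(\<lambda>\<omega>. interarrival (D \<omega>) l) \<in> borel_measurable N"
    using ev[of "Interarrival l"] l by (intro measurable_events_of[OF _ sp]) (auto simp: past_def)
  fix i assume i: "i < d"
  show "(\<lambda>\<omega>. choice (D \<omega>) l i) \<in> measurable N (count_space {..<n})"
    using ev[of "Choice l i"] l i measurable_space[OF choice_measurable[OF i]]
    by (intro measurable_events_of[OF _ sp]) (auto simp: past_def)
next
  fix l assume l: "l < m"
  show "(\<lambda>\<omega>. lifetime (D \<omega>) l) \<in> borel_measurable N"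
    using ev[of "Lifetime l"] l by (intro measurable_events_of[OF _ sp]) (auto simp: past_def)
qed

lemma past_subset_sources: "past d n m \<subseteq> sources d n"
  by (auto simp: past_def sources_def)

lemma upcoming_subset_sources: "upcoming d h m \<subseteq> sources d n"
  by (auto simp: upcoming_def sources_def)

lemma source_events_subset: "s \<in> sources d n \<Longrightarrow> source_events n M D s \<subseteq> sets M"
  using sources_indep by (auto simp: indep_sets_def)

lemma driven_by_M: "driven_by d n M D m"
  by (rule driven_by_source_events) (use source_events_subset past_subset_sources in auto)

text \<open>Encoded as a measure so that the lemmas on \<open>measurable\<close> apply; only its
  space and sets matter, and probabilities are always taken in \<open>M\<close>.\<close>

definition past_algebra :: "nat \<Rightarrow> 'a measure" where
  "past_algebra m = sigma (space M) (\<Union>s\<in>past d n m. source_events n M D s)"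

lemma past_events_Pow: "(\<Union>s\<in>past d n m. source_events n M D s) \<subseteq> Pow (space M)"
  using source_events_subset past_subset_sources sets.sets_into_space by blast

lemma space_past_algebra: "space (past_algebra m) = space M"
  by (simp add: past_algebra_def space_measure_of_conv)

lemma sets_past_algebra:
  "sets (past_algebra m) = sigma_sets (space M) (\<Union>s\<in>past d n m. source_events n M D s)"
  using past_events_Pow by (simp add: past_algebra_def)

lemma driven_by_past_algebra: "driven_by d n (past_algebra m) D m"
  by (rule driven_by_source_events) (auto simp: space_past_algebra sets_past_algebra)

lemma stack_event_in_source_events:
  assumes "s \<in> upcoming d h m" "j < n"
  shows "stack_event M D h j s \<in> source_events n M D s"
proof -
  have "{\<omega> \<in> space M. interarrival (D \<omega>) l \<le> 1 / real h}
      \<in> events_of M borel (\<lambda>\<omega>. interarrival (D \<omega>) l)" for l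
    by (rule in_events_ofI[of "{..1 / real h}"]) auto
  moreover have "{\<omega> \<in> space M. 1 < lifetime (D \<omega>) l} \<in> events_of M borel (\<lambda>\<omega>. lifetime (D \<omega>) l)" for l
    by (rule in_events_ofI[of "{1<..}"]) auto
  moreover have "{\<omega> \<in> space M. choice (D \<omega>) l i = j}
      \<in> events_of M (count_space {..<n}) (\<lambda>\<omega>. choice (D \<omega>) l i)" for l i
    by (rule in_events_ofI[of "{j}"]) (use assms(2) in auto)
  ultimately show ?thesis
    using assms(1) by (auto simp: upcoming_def)
qed

section \<open>Success probability of one block and of many blocks\<close>

lemma prob_choice:
  assumes "i < d" "j < n"
  shows "prob {\<omega> \<in> space M. choice (D \<omega>) l i = j} = 1 / real n"
proof -
  have "{\<omega> \<in> space M. choice (D \<omega>) l i = j} = (\<lambda>\<omega>. choice (D \<omega>) l i) -` {j} \<inter> space M" by auto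
  then have "prob {\<omega> \<in> space M. choice (D \<omega>) l i = j}
      = measure (distr M (count_space {..<n}) (\<lambda>\<omega>. choice (D \<omega>) l i)) {j}"
    using assms by (subst measure_distr[OF choice_measurable]) auto
  also have "\<dots> = 1 / real n"
    using assms by (simp add: choice_distr measure_uniform_count_measure)
  finally show ?thesis .
qed

lemma prob_interarrival_le:
  assumes "0 \<le> a"
  shows "prob {\<omega> \<in> space M. interarrival (D \<omega>) l \<le> a} = 1 - exp (- (lam * real n * a))"
  using exponential_distributedD_le[OF interarrival_distributed assms] lam n
  by (simp add: mult.commute)

lemma prob_stack_events:
  assumes j: "j < n"
  shows "(\<Prod>s\<in>upcoming d h m. prob (stack_event M D h j s)) = stack_prob lam d n h"
proof -
  let ?A = "Interarrival ` {m<..<m + h}"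
  let ?B = "(\<lambda>(l, i). Choice l i) ` ({m<..<m + h} \<times> {..<d})"
  let ?C = "Lifetime ` {m..<m + h}"
  let ?p = "\<lambda>s. prob (stack_event M D h j s)"
  have "(\<Prod>s\<in>upcoming d h m. ?p s) = prod ?p ?A * prod ?p ?B * prod ?p ?C"
  proof -
    have "prod ?p (?A \<union> ?B \<union> ?C) = prod ?p (?A \<union> ?B) * prod ?p ?C"
      by (rule prod.union_disjoint) auto
    also have "prod ?p (?A \<union> ?B) = prod ?p ?A * prod ?p ?B"
      by (rule prod.union_disjoint) auto
    finally show ?thesis by (simp only: upcoming_def)
  qed
  also have "prod ?p ?A = (\<Prod>l\<in>{m<..<m + h}. ?p (Interarrival l))"
    by (subst prod.reindex) (auto simp: inj_on_def)
  also have "\<dots> = (1 - exp (- (lam * real n / real h))) ^ (h - 1)"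
    by (simp add: prob_interarrival_le)
  also have "prod ?p ?B = (\<Prod>(l, i)\<in>{m<..<m + h} \<times> {..<d}. ?p (Choice l i))"
    by (subst prod.reindex) (auto simp: inj_on_def intro!: prod.cong)
  also have "\<dots> = (\<Prod>(l, i)\<in>{m<..<m + h} \<times> {..<d}. 1 / real n)"
    by (rule prod.cong) (auto simp: prob_choice j)
  also have "\<dots> = (1 / real n) ^ ((h - 1) * d)"
    by (simp add: split_beta)
  also have "prod ?p ?C = (\<Prod>l\<in>{m..<m + h}. ?p (Lifetime l))"
    by (subst prod.reindex) (auto simp: inj_on_def)
  also have "\<dots> = exp (- 1) ^ h"
    using exponential_distributedD_gt[OF lifetime_distributed, of 1] by simp
  finally show ?thesis by (simp only: stack_prob_def)
qed

text \<open>Split according to the bin \<open>j\<close> of ball \<open>m\<close>, which is a past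
  event. For fixed \<open>j\<close>, stacking is an intersection of upcoming events, independent of
  the past, and its probability is the same for every \<open>j\<close>; summing over
  \<open>j\<close> restores \<open>F\<close>.\<close>

lemma prob_past_Int_stacks:
  assumes h: "h > 0" and F: "F \<in> sets (past_algebra m)"
  shows "prob (F \<inter> {\<omega> \<in> space M. stacks d h (D \<omega>) m}) = prob F * stack_prob lam d n h"
proof -
  let ?G = "\<lambda>j. F \<inter> {\<omega> \<in> space M. ball_bin d (D \<omega>) m = j}"
  let ?S = "\<lambda>j. \<Inter>s\<in>upcoming d h m. stack_event M D h j s"
  have ne: "upcoming d h m \<noteq> {}" and fin: "finite (upcoming d h m)"
    using h by (auto simp: upcoming_def)
  have disj: "past d n m \<inter> upcoming d h m = {}" by (auto simp: past_def upcoming_def)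
  have bin: "{\<omega> \<in> space M. ball_bin d (D \<omega>) m = j} \<in> sets (past_algebra m)" for j
    using measurable_sets[OF measurable_ball_bin[OF d driven_by_past_algebra], of "{j}" m]
    by (simp add: vimage_def Int_def space_past_algebra conj_commute)
  have past_sub: "sets (past_algebra m) \<subseteq> sets M"
    unfolding sets_past_algebra
    by (intro sets.sigma_sets_subset UN_least source_events_subset subsetD[OF past_subset_sources])
  \<comment> \<open>This holds at every point, not just almost surely, since choices are measurable
    into \<open>count_space {..<n}\<close>.\<close>
  have bin_less: "ball_bin d (D \<omega>) m < n" if "\<omega> \<in> space M" for \<omega>
    using measurable_space[OF choice_measurable that] by (intro ball_bin_less[OF d]) auto
  have G: "prob (?G j \<inter> ?S j) = prob (?G j) * stack_prob lam d n h" if j: "j < n" for j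
  proof -
    have "prob (?G j \<inter> ?S j) = prob (?G j) * (\<Prod>s\<in>upcoming d h m. prob (stack_event M D h j s))"
    proof (rule indep_sets_prob_Int_INT[OF indep_sets_mono_index[OF _ sources_indep] disj fin ne])
      show "past d n m \<union> upcoming d h m \<subseteq> sources d n"
        using past_subset_sources upcoming_subset_sources by simp
      show "?G j \<in> sigma_sets (space M) (\<Union>s\<in>past d n m. source_events n M D s)"
        using sets.Int[OF F bin] by (simp add: sets_past_algebra)
    qed (simp_all add: Int_stable_source_events stack_event_in_source_events j)
    then show ?thesis by (simp add: prob_stack_events[OF j])
  qed
  have Ssets: "?S j \<in> sets M" if "j < n" for j
    using fin ne stack_event_in_source_events[OF _ that] source_events_subset upcoming_subset_sources
    by (intro sets.finite_INT) blast+
  have "F \<inter> {\<omega> \<in> space M. stacks d h (D \<omega>) m} = (\<Union>j\<in>{..<n}. ?G j \<inter> ?S j)"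
  proof -
    have "\<omega> \<in> ?S j \<longleftrightarrow> (\<forall>l\<in>{m<..<m + h}. interarrival (D \<omega>) l \<le> 1 / real h) \<and>
        (\<forall>l\<in>{m<..<m + h}. \<forall>i\<in>{..<d}. choice (D \<omega>) l i = j) \<and> (\<forall>l\<in>{m..<m + h}. 1 < lifetime (D \<omega>) l)"
      if "\<omega> \<in> space M" for \<omega> j
      using that by (simp add: upcoming_def ball_Un split_beta)
    then have "stacks d h (D \<omega>) m \<longleftrightarrow> \<omega> \<in> ?S (ball_bin d (D \<omega>) m)" if "\<omega> \<in> space M" for \<omega>
      using that unfolding stacks_def by blast
    then show ?thesis using bin_less by auto
  qed
  also have "prob \<dots> = (\<Sum>j<n. prob (?G j \<inter> ?S j))"
    using F bin past_sub Ssets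
    by (intro finite_measure_finite_Union) (auto simp: disjoint_family_on_def)
  also have "\<dots> = (\<Sum>j<n. prob (?G j)) * stack_prob lam d n h"
    by (simp add: G sum_distrib_right)
  also have "(\<Sum>j<n. prob (?G j)) = prob (\<Union>j\<in>{..<n}. ?G j)"
    using F bin past_sub
    by (intro finite_measure_finite_Union[symmetric]) (auto simp: disjoint_family_on_def)
  also have "(\<Union>j\<in>{..<n}. ?G j) = F"
    using sets.sets_into_space[OF F] bin_less by (auto simp: space_past_algebra)
  finally show ?thesis .
qed

text \<open>Block \<open>b\<close> consists of the balls from \<open>b * h\<close> to
  \<open>b * h + h - 1\<close>. Failure of the first \<open>B\<close> blocks belongs to the past of
  ball \<open>B * h\<close>, so each further block contributes an independent factor.\<close>

lemma prob_no_stack: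
  assumes h: "h > 0"
  shows "prob {\<omega> \<in> space M. \<forall>b<B. \<not> stacks d h (D \<omega>) (b * h)} = (1 - stack_prob lam d n h) ^ B"
proof (induction B)
  case 0
  then show ?case by (simp add: prob_space)
next
  case (Suc B)
  let ?F = "{\<omega> \<in> space M. \<forall>b<B. \<not> stacks d h (D \<omega>) (b * h)}"
  let ?S = "{\<omega> \<in> space M. stacks d h (D \<omega>) (B * h)}"
  have pred: "Measurable.pred N (\<lambda>\<omega>. \<forall>b\<in>{..<B}. \<not> stacks d h (D \<omega>) (b * h))"
    if dr: "driven_by d n N D (B * h)" for N
  proof (intro pred_intros_finite(3) pred_intros_logic(2) measurable_stacks[OF d])
    fix b assume "b \<in> {..<B}"
    then have "Suc b * h \<le> B * h" by (intro mult_le_mono1) auto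
    then show "driven_by d n N D (b * h + h)"
      by (intro driven_by_mono[OF dr]) simp
  qed simp
  have F: "?F \<in> sets (past_algebra (B * h))"
    using pred[OF driven_by_past_algebra] by (simp only: pred_def space_past_algebra Ball_def lessThan_iff)
  have FM: "?F \<in> sets M" using pred[OF driven_by_M] by (simp only: pred_def Ball_def lessThan_iff)
  have S: "?S \<in> sets M"
    using measurable_stacks[OF d driven_by_M, of h "B * h"] by (simp only: pred_def)
  have split: "{\<omega> \<in> space M. \<forall>b<Suc B. \<not> stacks d h (D \<omega>) (b * h)} = ?F - (?F \<inter> ?S)"
    unfolding All_less_Suc by blast
  have "prob (?F - (?F \<inter> ?S)) = prob ?F - prob (?F \<inter> ?S)"
    by (rule finite_measure_Diff[OF FM sets.Int[OF FM S] Int_lower1])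
  then show ?case
    unfolding split prob_past_Int_stacks[OF h F] Suc.IH by (simp add: algebra_simps)
qed

subsection \<open>The arrival times\<close>

lemma AE_interarrival_nonneg: "AE \<omega> in M. \<forall>i. 0 \<le> interarrival (D \<omega>) i"
proof -
  have "AE \<omega> in M. 0 \<le> interarrival (D \<omega>) i" for i
  proof -
    have "prob {\<omega> \<in> space M. 0 < interarrival (D \<omega>) i} = 1"
      using exponential_distributedD_gt[OF interarrival_distributed, of 0] lam n by simp
    from AE_prob_1[OF this] show ?thesis by eventually_elim auto
  qed
  then show ?thesis by (simp add: AE_all_countable)
qed

text \<open>The first \<open>N\<close> gaps are all at most \<open>T\<close> with probability
  \<open>q ^ N\<close> for some \<open>q < 1\<close>, which tends to 0. A single gap longer than
  \<open>T\<close> already rules out infinitely many arrivals by time \<open>T\<close>.\<close>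

lemma AE_ex_interarrival_gt:
  assumes T: "0 \<le> T"
  shows "AE \<omega> in M. \<exists>i. T < interarrival (D \<omega>) i"
proof -
  let ?Z = "{\<omega> \<in> space M. \<forall>i. interarrival (D \<omega>) i \<le> T}"
  let ?q = "1 - exp (- (lam * real n * T))"
  note [measurable] = interarrival_measurable
  have Z: "?Z \<in> sets M" by measurable
  have le: "prob ?Z \<le> ?q ^ N" if "N > 0" for N
  proof -
    let ?J = "Interarrival ` {..<N}"
    let ?A = "\<lambda>s. case s of Interarrival i \<Rightarrow> {\<omega> \<in> space M. interarrival (D \<omega>) i \<le> T} | _ \<Rightarrow> {}"
    have ev: "\<forall>s\<in>?J. ?A s \<in> source_events n M D s"
    proof
      fix s assume "s \<in> ?J"
      moreover have "{\<omega> \<in> space M. interarrival (D \<omega>) i \<le> T}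
          \<in> events_of M borel (\<lambda>\<omega>. interarrival (D \<omega>) i)" for i
        by (rule in_events_ofI[of "{..T}"]) auto
      ultimately show "?A s \<in> source_events n M D s" by auto
    qed
    have J: "?J \<subseteq> sources d n" "?J \<noteq> {}" "finite ?J" using that by (auto simp: sources_def)
    have "?Z \<subseteq> (\<Inter>s\<in>?J. ?A s)" by auto
    moreover have "(\<Inter>s\<in>?J. ?A s) \<in> sets M"
      using J ev source_events_subset by (intro sets.finite_INT) blast+
    ultimately have "prob ?Z \<le> prob (\<Inter>s\<in>?J. ?A s)" by (rule finite_measure_mono)
    also have "\<dots> = (\<Prod>s\<in>?J. prob (?A s))" by (rule indep_setsD[OF sources_indep J ev])
    also have "\<dots> = (\<Prod>i<N. prob (?A (Interarrival i)))"
      by (subst prod.reindex) (auto simp: inj_on_def)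
    also have "\<dots> = ?q ^ N" by (simp add: prob_interarrival_le[OF T])
    finally show ?thesis .
  qed
  have "(\<lambda>N. ?q ^ N) \<longlonglongrightarrow> 0"
    using lam T by (intro LIMSEQ_power_zero) simp
  then have "prob ?Z \<le> 0"
    by (rule LIMSEQ_le_const) (use le in \<open>auto intro!: exI[of _ 1]\<close>)
  then have "prob ?Z = 0" using measure_nonneg[of M ?Z] by linarith
  then have "AE \<omega> in M. \<omega> \<notin> ?Z" using prob_eq_0[OF Z] by simp
  then show ?thesis by (rule AE_mp) (auto intro!: AE_I2 simp: not_le)
qed

lemma finite_arrivals:
  assumes ia: "\<And>i. 0 \<le> interarrival w i" and "T < interarrival w i"
  shows "finite {k. arrival w k \<le> T}"
proof (rule finite_subset)
  show "{k. arrival w k \<le> T} \<subseteq> {..<i}"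
  proof
    fix k assume k: "k \<in> {k. arrival w k \<le> T}"
    show "k \<in> {..<i}"
    proof (rule ccontr)
      assume "k \<notin> {..<i}"
      then have "interarrival w i \<le> arrival w k"
        unfolding arrival_def by (intro member_le_sum ia) auto
      with k assms(2) show False by simp
    qed
  qed
qed simp

lemma prob_arrival_gt:
  assumes T: "T > 0"
  shows "prob {\<omega> \<in> space M. T < arrival (D \<omega>) k} \<le> real (k + 1) / (lam * real n * T)"
proof -
  have E: "expectation (\<lambda>\<omega>. interarrival (D \<omega>) i) = 1 / (lam * real n)" for i
    using exponential_distributed_expectation[OF _ interarrival_distributed] lam n by simp
  \<comment> \<open>A function that is not integrable has integral 0 by convention, whereas the
    expectation computed above is positive.\<close>
  have int: "integrable M (\<lambda>\<omega>. interarrival (D \<omega>) i)" for i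
    using E[of i] lam n not_integrable_integral_eq[of M "\<lambda>\<omega>. interarrival (D \<omega>) i"] by force
  have intA: "integrable M (\<lambda>\<omega>. arrival (D \<omega>) k)"
    unfolding arrival_def by (intro Bochner_Integration.integrable_sum int)
  have "prob {\<omega> \<in> space M. T < arrival (D \<omega>) k} \<le> prob {\<omega> \<in> space M. T \<le> arrival (D \<omega>) k}"
    using borel_measurable_integrable[OF intA] by (intro finite_measure_mono) auto
  also have "\<dots> \<le> expectation (\<lambda>\<omega>. arrival (D \<omega>) k) / T"
  proof (rule integral_Markov_inequality_measure[OF intA sets.empty_sets _ T])
    show "AE \<omega> in M. 0 \<le> arrival (D \<omega>) k"
      using AE_interarrival_nonneg by eventually_elim (simp add: arrival_nonneg)
  qed
  also have "expectation (\<lambda>\<omega>. arrival (D \<omega>) k) = real (k + 1) / (lam * real n)"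
    unfolding arrival_def by (subst Bochner_Integration.integral_sum) (simp_all add: int E)
  finally show ?thesis by simp
qed

subsection \<open>The maximum load for a fixed number of bins\<close>

text \<open>Outside a null set, the load \<open>h\<close> can be missed only if no block among the
  first \<open>B\<close> stacks or if ball \<open>B * h - 1\<close>, the last of these blocks,
  arrives after \<open>T\<close>. The two subtracted terms bound these probabilities.\<close>

lemma prob_max_load_upto_ge:
  assumes h: "h > 0" and B: "B > 0" and T: "T > 0"
  shows "1 - (1 - stack_prob lam d n h) ^ B - real (B * h) / (lam * real n * T)
    \<le> measure (completion M) {\<omega> \<in> space M. h \<le> max_load_upto d n (D \<omega>) T}"
proof -
  let ?G = "{\<omega> \<in> space M. (\<forall>i. 0 \<le> interarrival (D \<omega>) i) \<and> (\<exists>i. T < interarrival (D \<omega>) i)}"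
  let ?W = "\<lambda>\<omega>. \<exists>j\<in>{..<n}. h \<le> load d (D \<omega>) 0 j \<or>
    (\<exists>m. arrival (D \<omega>) m \<le> T \<and> h \<le> load d (D \<omega>) (arrival (D \<omega>) m) j)"
  let ?E = "{\<omega> \<in> space M. h \<le> max_load_upto d n (D \<omega>) T}"
  let ?E' = "{\<omega> \<in> space M. ?W \<omega>}"
  let ?N = "{\<omega> \<in> space M. \<forall>b<B. \<not> stacks d h (D \<omega>) (b * h)}"
  let ?L = "{\<omega> \<in> space M. T < arrival (D \<omega>) (B * h - 1)}"
  note [measurable] = interarrival_measurable measurable_arrival[OF driven_by_M]
  have G: "?G \<in> sets M" by measurable
  have null: "space M - ?G \<in> null_sets M"
  proof -
    have "AE \<omega> in M. \<omega> \<in> ?G"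
      using AE_interarrival_nonneg AE_ex_interarrival_gt[OF less_imp_le[OF T]] AE_space
      by eventually_elim auto
    then have "AE \<omega> in M. \<omega> \<notin> space M - ?G" by eventually_elim auto
    then show ?thesis using G by (subst (asm) AE_iff_null_sets[symmetric]) auto
  qed
  \<comment> \<open>Off a null set, the uncountable maximum over time is attained at time \<open>0\<close> or at an arrival.\<close>
  have E': "?E' \<in> sets M"
  proof -
    have "Measurable.pred M (\<lambda>\<omega>. h \<le> load d (D \<omega>) 0 j \<or>
      (\<exists>m. arrival (D \<omega>) m \<le> T \<and> h \<le> load d (D \<omega>) (arrival (D \<omega>) m) j))" if "j \<in> {..<n}" for j
    proof -
      have [measurable]: "(\<lambda>\<omega>. load d (D \<omega>) 0 j) \<in> measurable M (count_space UNIV)"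
        "\<And>m. (\<lambda>\<omega>. load d (D \<omega>) (arrival (D \<omega>) m) j) \<in> measurable M (count_space UNIV)"
        using that by (auto intro!: measurable_load[OF d driven_by_M] measurable_arrival[OF driven_by_M])
      show ?thesis by measurable
    qed
    then have "Measurable.pred M ?W" by (intro pred_intros_finite(4)) auto
    then show ?thesis by (simp only: pred_def)
  qed
  have iff: "\<omega> \<in> ?E \<longleftrightarrow> \<omega> \<in> ?E'" if "\<omega> \<in> ?G" for \<omega>
  proof -
    have ia: "\<And>i. 0 \<le> interarrival (D \<omega>) i" using that by auto
    have "finite {k. arrival (D \<omega>) k \<le> T}" using that finite_arrivals[OF ia] by blast
    from le_max_load_upto_iff[OF n _ ia this] T show ?thesis by auto
  qed
  have EG: "?E' \<inter> ?G \<in> sets M" using E' G by (rule sets.Int)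
  \<comment> \<open>The first piece is measurable in \<open>M\<close> and the second lies in a null
    set, so the union is measurable in the completion.\<close>
  have "?E = (?E' \<inter> ?G) \<union> (?E - ?G)" using iff by auto
  then have E: "?E \<in> sets (completion M)"
    by (rule sets_completionI[OF _ _ null EG]) auto
  have Nsets: "?N \<in> sets M"
  proof -
    have "Measurable.pred M (\<lambda>\<omega>. \<forall>b\<in>{..<B}. \<not> stacks d h (D \<omega>) (b * h))"
      by (intro pred_intros_finite(3) pred_intros_logic(2) measurable_stacks[OF d driven_by_M]) simp
    then show ?thesis by (simp only: pred_def Ball_def lessThan_iff)
  qed
  have L: "?L \<in> sets M" by measurable
  note NL = sets.Un[OF Nsets L] and Gc = null_setsD2[OF null]
  have sub: "space M - (?E' \<inter> ?G) \<subseteq> (?N \<union> ?L) \<union> (space M - ?G)"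
  proof
    fix \<omega> assume \<omega>: "\<omega> \<in> space M - (?E' \<inter> ?G)"
    show "\<omega> \<in> (?N \<union> ?L) \<union> (space M - ?G)"
    proof (rule ccontr)
      assume "\<omega> \<notin> (?N \<union> ?L) \<union> (space M - ?G)"
      with \<omega> have \<omega>G: "\<omega> \<in> ?G" and arr: "arrival (D \<omega>) (B * h - 1) \<le> T"
        and "\<exists>b<B. stacks d h (D \<omega>) (b * h)" by auto
      then obtain b where b: "b < B" and st: "stacks d h (D \<omega>) (b * h)" by auto
      have ia: "\<And>i. 0 \<le> interarrival (D \<omega>) i" using \<omega>G by auto
      have fin: "finite {k. arrival (D \<omega>) k \<le> T}" using \<omega>G finite_arrivals[OF ia] by blast
      have "Suc b * h \<le> B * h" using b by (intro mult_le_mono1) auto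
      then have "arrival (D \<omega>) (b * h + h - 1) \<le> arrival (D \<omega>) (B * h - 1)"
        by (intro arrival_mono ia) simp
      with arr have T': "arrival (D \<omega>) (b * h + h - 1) \<le> T" by simp
      have "h \<le> load d (D \<omega>) (arrival (D \<omega>) (b * h + h - 1)) (ball_bin d (D \<omega>) (b * h))"
        by (rule stacks_load[OF d h ia fin T' st])
      moreover have "ball_bin d (D \<omega>) (b * h) < n"
        using measurable_space[OF choice_measurable] \<omega> by (intro ball_bin_less[OF d]) auto
      ultimately have "\<omega> \<in> ?E'" using T' \<omega> by blast
      with \<omega>G \<omega> show False by blast
    qed
  qed
  have "prob (space M - (?E' \<inter> ?G)) \<le> prob ((?N \<union> ?L) \<union> (space M - ?G))"
    by (rule finite_measure_mono[OF sub sets.Un[OF NL Gc]])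
  moreover have "prob ((?N \<union> ?L) \<union> (space M - ?G)) \<le> prob (?N \<union> ?L) + prob (space M - ?G)"
    by (rule measure_Un_le[OF NL Gc])
  moreover have "prob (?N \<union> ?L) \<le> prob ?N + prob ?L"
    by (rule measure_Un_le[OF Nsets L])
  moreover have "prob ?L \<le> real (B * h) / (lam * real n * T)"
    using prob_arrival_gt[OF T, of "B * h - 1"] h B by simp
  moreover have "measure (completion M) (?E' \<inter> ?G) \<le> measure (completion M) ?E"
  proof (rule finite_measure.finite_measure_mono)
    show "finite_measure (completion M)"
      by (rule finite_measureI) (simp add: emeasure_space_1)
    show "?E' \<inter> ?G \<subseteq> ?E"
    proof
      fix \<omega> assume "\<omega> \<in> ?E' \<inter> ?G"
      then show "\<omega> \<in> ?E" using iff[THEN iffD2] by (elim IntE)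
    qed
  qed (rule E)
  ultimately show ?thesis
    using prob_compl[OF EG] measure_eq_0_null_sets[OF null] prob_no_stack[OF h, of B]
      measure_completion[OF EG]
    by linarith
qed

end

subsection \<open>Asymptotics\<close>

lemma stack_prob_bounds:
  assumes lam: "lam > 0"
  shows "0 \<le> stack_prob lam d n h" "stack_prob lam d n h \<le> 1"
proof -
  have "0 \<le> 1 - exp (- (lam * real n / real h))" "1 - exp (- (lam * real n / real h)) \<le> 1"
    using lam by simp_all
  \<comment> \<open>For \<open>n = 0\<close> the quotient is 0 by convention.\<close>
  moreover have "1 / real n \<le> 1" by (cases n) auto
  ultimately show "0 \<le> stack_prob lam d n h" "stack_prob lam d n h \<le> 1"
    unfolding stack_prob_def
    by (auto intro!: mult_nonneg_nonneg mult_le_one power_le_one zero_le_power)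
qed

text \<open>The gaps and the lifetimes each cost at most a factor \<open>exp (- h)\<close>. The
  choices cost only \<open>(h - 1) * d\<close> factors \<open>1 / n\<close>, as the first ball is
  free to go anywhere; this saved ball absorbs the rounding up of \<open>L\<close> to
  \<open>h\<close>.\<close>

lemma stack_prob_ge:
  assumes lam: "lam > 0" and h: "h > 0" and L: "real h \<le> L + 1" and n: "n > 0"
    and half: "ln 2 \<le> lam * real n / (L + 1)"
  shows "exp (- 2 * (L + 1)) / real n powr (L * real d) \<le> stack_prob lam d n h"
proof -
  have "ln 2 \<le> lam * real n / real h"
    using half divide_left_mono[OF L, of "lam * real n"] lam h L by simp
  then have "exp (- (lam * real n / real h)) \<le> exp (- ln 2)" by simp
  also have "\<dots> = 1 / 2" by (simp add: exp_minus inverse_eq_divide)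
  finally have "(1 / 2) ^ (h - 1) \<le> (1 - exp (- (lam * real n / real h))) ^ (h - 1)"
    by (intro power_mono) auto
  moreover have "(1 / 2 :: real) ^ h \<le> (1 / 2) ^ (h - 1)" by (intro power_decreasing) auto
  \<comment> \<open>From \<open>exp 1 >= 2\<close>; this lets the gap factor be bounded by the same
    power as the lifetime factor.\<close>
  moreover have "exp (- 1) ^ h \<le> (1 / 2 :: real) ^ h"
    using exp_ge_add_one_self[of "1::real"] by (intro power_mono) (auto simp: exp_minus field_simps)
  ultimately have 1: "exp (- 1) ^ h \<le> (1 - exp (- (lam * real n / real h))) ^ (h - 1)"
    by linarith
  have "real ((h - 1) * d) \<le> L * real d"
    using L h by (auto intro!: mult_right_mono simp: of_nat_diff)
  then have "real n powr real ((h - 1) * d) \<le> real n powr (L * real d)"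
    using n by (intro powr_mono) auto
  then have "1 / real n powr (L * real d) \<le> 1 / real n ^ ((h - 1) * d)"
    using n by (intro divide_left_mono) (auto simp: powr_realpow simp del: of_nat_mult)
  then have 2: "1 / real n powr (L * real d) \<le> (1 / real n) ^ ((h - 1) * d)"
    by (simp add: power_one_over)
  have "exp (- 2 * (L + 1)) / real n powr (L * real d)
      \<le> exp (- 2 * real h) / real n powr (L * real d)"
    using L by (intro divide_right_mono) auto
  also have "\<dots> = exp (- 1) ^ h * (1 / real n powr (L * real d)) * exp (- 1) ^ h"
    by (simp flip: exp_of_nat_mult exp_add)
  also have "\<dots> \<le> stack_prob lam d n h"
    unfolding stack_prob_def
    by (intro mult_right_mono mult_mono 1 2) (use lam in auto)
  finally show ?thesis .
qed

text \<open>About \<open>lam * n * T\<close> balls arrive by time \<open>T\<close>. Using only about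
  the fraction \<open>1 / sqrt n\<close> of them makes Markov's bound \<open>1 / sqrt n\<close>,
  while the expected number of successful blocks is still at least of order \<open>sqrt n\<close>
  times a factor depending on \<open>L\<close> alone.\<close>

lemma (in n_bins) prob_max_load_upto_ge_real:
  fixes L :: real
  defines "T \<equiv> real n powr (L * real d)"
  assumes L: "L > 0" and half: "ln 2 \<le> lam * real n / (L + 1)"
    and B: "1 \<le> lam * sqrt (real n) / (L + 1)"
  shows "1 - exp (1 - lam * sqrt (real n) * exp (- 2 * (L + 1)) / (L + 1)) - 1 / sqrt (real n)
    \<le> measure (completion M) {\<omega> \<in> space M. L \<le> real (max_load_upto d n (D \<omega>) T)}"
proof -
  define h where "h = nat \<lceil>L\<rceil>"
  define x where "x = lam * sqrt (real n) * T / real h"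
  define B where "B = nat \<lfloor>x\<rfloor>"
  let ?q = "stack_prob lam d n h"
  have h: "h > 0" and hL: "real h \<le> L + 1"
    using L unfolding h_def by linarith+
  have T: "1 \<le> T" using n L unfolding T_def by (intro ge_one_powr_ge_zero) auto
  have xL: "lam * sqrt (real n) * T / (L + 1) \<le> x"
    unfolding x_def using lam T h hL L by (intro divide_left_mono) auto
  have "1 \<le> lam * sqrt (real n) / (L + 1) * T"
    using B T by (metis mult_mono' mult_1 zero_le_one)
  also have "\<dots> \<le> x" using xL by simp
  finally have x: "1 \<le> x" .
  have Bpos: "B > 0" using x unfolding B_def by linarith
  have Bx: "real B \<le> x" and Bge: "x - 1 \<le> real B" using x unfolding B_def by linarith+
  have q0: "0 \<le> ?q" and q1: "?q \<le> 1" using stack_prob_bounds[OF lam] by auto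
  have "exp (- 2 * (L + 1)) / T \<le> ?q"
    using stack_prob_ge[OF lam h hL n half] by (simp add: T_def)
  then have "exp (- 2 * (L + 1)) / T * (lam * sqrt (real n) * T / (L + 1)) \<le> ?q * x"
    using xL lam L T q0 by (intro mult_mono) auto
  moreover have "exp (- 2 * (L + 1)) / T * (lam * sqrt (real n) * T / (L + 1))
      = lam * sqrt (real n) * exp (- 2 * (L + 1)) / (L + 1)"
    using T by simp
  \<comment> \<open>Rounding \<open>x\<close> down to \<open>B\<close> loses at most one block, that
    is at most \<open>?q <= 1\<close> in the exponent; this is the 1 inside the exponential of the
    conclusion.\<close>
  ultimately have "lam * sqrt (real n) * exp (- 2 * (L + 1)) / (L + 1) - 1 \<le> ?q * x - ?q"
    using q1 by linarith
  also have "\<dots> \<le> ?q * real B" using mult_left_mono[OF Bge q0] by (simp add: algebra_simps)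
  finally have qB: "lam * sqrt (real n) * exp (- 2 * (L + 1)) / (L + 1) - 1 \<le> ?q * real B" .
  have "(1 - ?q) ^ B \<le> exp (- ?q) ^ B"
    using q1 exp_ge_add_one_self[of "- ?q"] by (intro power_mono) auto
  also have "\<dots> = exp (- (?q * real B))"
    by (simp flip: exp_of_nat_mult add: mult.commute)
  also have "\<dots> \<le> exp (1 - lam * sqrt (real n) * exp (- 2 * (L + 1)) / (L + 1))"
    using qB by simp
  finally have 1: "(1 - ?q) ^ B \<le> exp (1 - lam * sqrt (real n) * exp (- 2 * (L + 1)) / (L + 1))" .
  have "real (B * h) / (lam * real n * T) \<le> x * real h / (lam * real n * T)"
    using Bx lam T by (intro divide_right_mono) (auto intro: mult_right_mono)
  also have "\<dots> = sqrt (real n) / real n"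
    using h lam T unfolding x_def by simp
  also have "\<dots> = 1 / sqrt (real n)" using n by (simp add: field_simps)
  finally have 2: "real (B * h) / (lam * real n * T) \<le> 1 / sqrt (real n)" .
  have "{\<omega> \<in> space M. L \<le> real (max_load_upto d n (D \<omega>) T)}
      = {\<omega> \<in> space M. h \<le> max_load_upto d n (D \<omega>) T}"
    unfolding h_def by (simp add: nat_ceiling_le_eq)
  with prob_max_load_upto_ge[OF h Bpos, of T] T 1 2 show ?thesis by simp
qed

theorem mainTheorem6:
  fixes lam K :: real and d :: nat
    and M :: "nat \<Rightarrow> 'a measure" and D :: "nat \<Rightarrow> 'a \<Rightarrow> driving"
    and \<tau> :: "nat \<Rightarrow> real"
  assumes "lam > 0" and "d \<ge> 2" and "K > 0"
    and "\<And>n. n \<ge> 1 \<Longrightarrow> n_bin_system lam d n (M n) (D n)"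
    and "\<And>n. n \<ge> 1 \<Longrightarrow> starts_stationary d n (M n) (D n)"
    and "\<And>n. \<tau> n = real n powr (K * real d * ln (ln (real n)))"
  shows "(\<lambda>n. measure (completion (M n))
            {\<omega> \<in> space (M n). real (max_load_upto d n (D n \<omega>) (\<tau> n)) \<ge> K * ln (ln (real n))})
         \<longlonglongrightarrow> 1"
proof (rule tendsto_sandwich)
  let ?L = "\<lambda>n::nat. K * ln (ln (real n))"
  let ?f = "\<lambda>n::nat. 1 - exp (1 - lam * sqrt (real n) * exp (- 2 * (?L n + 1)) / (?L n + 1)) - 1 / sqrt (real n)"
  have lam: "lam > 0" and K: "K > 0" by fact+
  \<comment> \<open>Here \<open>exp (- 2 * (?L n + 1))\<close> is a constant times the power
    \<open>- 2 * K\<close> of \<open>ln n\<close>, so \<open>sqrt n\<close> dominates and the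
    exponent tends to minus infinity.\<close>
  show "?f \<longlonglongrightarrow> 1" using lam K by real_asymp
  \<comment> \<open>The bound for fixed \<open>n\<close> requires a positive level, which the
    iterated logarithm gives only for large \<open>n\<close>.\<close>
  have "\<forall>\<^sub>F n in sequentially. 0 < ?L n" using K by real_asymp
  moreover have "\<forall>\<^sub>F n in sequentially. ln 2 \<le> lam * real n / (?L n + 1)"
    using lam K by real_asymp
  moreover have "\<forall>\<^sub>F n in sequentially. 1 \<le> lam * sqrt (real n) / (?L n + 1)"
    using lam K by real_asymp
  ultimately show "\<forall>\<^sub>F n in sequentially. ?f n \<le> measure (completion (M n))
      {\<omega> \<in> space (M n). real (max_load_upto d n (D n \<omega>) (\<tau> n)) \<ge> ?L n}"
    using eventually_ge_at_top[of 1]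
  proof eventually_elim
    case (elim n)
    interpret prob_space "M n" using assms(4)[OF elim(4)] by (simp add: n_bin_system_def)
    interpret n_bins "M n" lam d n "D n"
      by unfold_locales (use assms(1,2) assms(4)[OF elim(4)] elim(4) in auto)
    have "\<tau> n = real n powr (?L n * real d)" by (simp add: assms(6) mult_ac)
    with prob_max_load_upto_ge_real[OF elim(1-3)] show ?case by simp
  qed
  show "\<forall>\<^sub>F n in sequentially. measure (completion (M n))
      {\<omega> \<in> space (M n). real (max_load_upto d n (D n \<omega>) (\<tau> n)) \<ge> ?L n} \<le> 1"
    using eventually_ge_at_top[of 1]
  proof eventually_elim
    case (elim n)
    interpret prob_space "M n" using assms(4)[OF elim] by (simp add: n_bin_system_def)
    have "prob_space (completion (M n))"
      by (rule prob_spaceI) (simp add: emeasure_space_1)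
    then show ?case by (rule prob_space.prob_le_1)
  qed
qed simp

end
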